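(* Let $H$ be a complex Hilbert space, let $T\in\mathcal{B}(H)$, let $T=V|T|$ be the polar decomposition of $T$, and let $M(T)$ be the mean transform of $T$. Then $$\ker(M(T))=\ker(T)=\ker(V)\quad\text{and}\quad \ker(V^* )\cap\ker(V)\subseteq\ker(M(T)^* ).$$ Moreover, if $T$ is binormal, then $\ker(M(T)^* )=\ker(V^* )$.
   Context: $\mathcal{B}(H)$ is the algebra of bounded linear operators on the Hilbert space $H$. For $T\in\mathcal{B}(H)$, $|T|=(T^*T)^{1/2}$, and the polar decomposition $T=V|T|$ is the canonical one: $V$ is the unique partial isometry with $T=V|T|$ and $\ker(V)=\ker(T)$. The mean transform of $T$ is $M(T)=\frac{1}{2}(V|T|+|T|V)=\frac12(T+|T|V)$. The operator $T$ is binormal if $T^*T$ and $TT^*$ commute. *)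

theory Defs
  imports "HOL-Analysis.Analysis"
begin

text \<open>
  A complex inner product space is modelled as a real inner product space (which supplies norm and
  topology) with a compatible complex structure; the complex inner product is linear in its first
  argument and its real part is the underlying real inner product, so
  \<open>cinner x x = complex_of_real ((norm x)\<^sup>2)\<close> and positive definiteness is inherited.
\<close>

class complex_inner = real_inner +
  fixes scaleC :: "complex \<Rightarrow> 'a \<Rightarrow> 'a"  (infixr "*\<^sub>C" 75)
    and cinner :: "'a \<Rightarrow> 'a \<Rightarrow> complex"
  assumes scaleC_add_right: "a *\<^sub>C (x + y) = a *\<^sub>C x + a *\<^sub>C y"
    and scaleC_add_left: "(a + b) *\<^sub>C x = a *\<^sub>C x + b *\<^sub>C x"
    and scaleC_scaleC: "a *\<^sub>C (b *\<^sub>C x) = (a * b) *\<^sub>C x"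
    and scaleC_of_real: "complex_of_real r *\<^sub>C x = r *\<^sub>R x"
    and cinner_commute: "cinner x y = cnj (cinner y x)"
    and cinner_add_left: "cinner (x + y) z = cinner x z + cinner y z"
    and cinner_scaleC_left: "cinner (a *\<^sub>C x) y = a * cinner x y"
    and Re_cinner: "Re (cinner x y) = inner x y"

class chilbert_space = complex_inner + complete_space

definition bounded_clinear :: "('a::complex_inner \<Rightarrow> 'b::complex_inner) \<Rightarrow> bool" where
  "bounded_clinear T \<longleftrightarrow> bounded_linear T \<and> (\<forall>c x. T (c *\<^sub>C x) = c *\<^sub>C T x)"

definition ker :: "('a::complex_inner \<Rightarrow> 'b::complex_inner) \<Rightarrow> 'a set" where
  "ker T = {x. T x = 0}"

text \<open>
  The adjoint, the positive square root and the polar factor are definite descriptions. On a complex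
  Hilbert space each object exists and is unique for a bounded operator (the square root for a
  positive one); elsewhere the values are unspecified.
\<close>

definition cadjoint :: "('a::complex_inner \<Rightarrow> 'b::complex_inner) \<Rightarrow> 'b \<Rightarrow> 'a" where
  "cadjoint T = (THE S. bounded_clinear S \<and> (\<forall>x y. cinner (T x) y = cinner x (S y)))"

definition positive_op :: "('a::complex_inner \<Rightarrow> 'a) \<Rightarrow> bool" where
  "positive_op A \<longleftrightarrow> bounded_clinear A \<and> (\<forall>x. cinner (A x) x \<in> \<real>\<^sub>\<ge>\<^sub>0)"

definition sqrt_op :: "('a::complex_inner \<Rightarrow> 'a) \<Rightarrow> 'a \<Rightarrow> 'a" where
  "sqrt_op A = (THE B. positive_op B \<and> B \<circ> B = A)"

definition abs_op :: "('a::complex_inner \<Rightarrow> 'a) \<Rightarrow> 'a \<Rightarrow> 'a" where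
  "abs_op T = sqrt_op (cadjoint T \<circ> T)"

definition partial_isometry :: "('a::complex_inner \<Rightarrow> 'a) \<Rightarrow> bool" where
  "partial_isometry V \<longleftrightarrow> bounded_clinear V \<and>
     (\<forall>x. (\<forall>y\<in>ker V. cinner x y = 0) \<longrightarrow> norm (V x) = norm x)"

definition polar_decomposition :: "('a::complex_inner \<Rightarrow> 'a) \<Rightarrow> ('a \<Rightarrow> 'a) \<Rightarrow> bool" where
  "polar_decomposition T V \<longleftrightarrow>
     partial_isometry V \<and> T = V \<circ> abs_op T \<and> ker V = ker T"

definition polar_factor :: "('a::complex_inner \<Rightarrow> 'a) \<Rightarrow> 'a \<Rightarrow> 'a" where
  "polar_factor T = (THE V. polar_decomposition T V)"

definition mean_transform :: "('a::complex_inner \<Rightarrow> 'a) \<Rightarrow> 'a \<Rightarrow> 'a" where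
  "mean_transform T =
     (\<lambda>x. (1 / 2) *\<^sub>R (polar_factor T (abs_op T x) + abs_op T (polar_factor T x)))"

definition binormal :: "('a::complex_inner \<Rightarrow> 'a) \<Rightarrow> bool" where
  "binormal T \<longleftrightarrow>
     (cadjoint T \<circ> T) \<circ> (T \<circ> cadjoint T) = (T \<circ> cadjoint T) \<circ> (cadjoint T \<circ> T)"

end

theory Submission
  imports Defs
begin

text \<open>
  Write \<open>P = |T|\<close>, so that \<open>T = V P\<close>, \<open>P\<close> is positive, \<open>V\<^sup>* V P = P\<close>, and \<open>P\<close>, \<open>T\<close> and \<open>V\<close> have the
  same kernel. The mean transform is \<open>M = (V P + P V) / 2\<close> and its adjoint is
  \<open>M\<^sup>* = (P V\<^sup>* + V\<^sup>* P) / 2\<close>.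

  If \<open>M x = 0\<close>, then \<open>V P x = - P V x\<close>, so \<open>\<langle>P x, x\<rangle> = \<langle>V P x, V x\<rangle> = - \<langle>P V x, V x\<rangle> \<le> 0\<close>. Positivity of
  \<open>P\<close> then gives \<open>\<langle>P x, x\<rangle> = 0\<close> and so \<open>P x = 0\<close>. Conversely a vector killed by \<open>V\<close> is killed by
  \<open>P\<close>, hence by \<open>M\<close>; the same remark shows that a vector killed by \<open>V\<close> and \<open>V\<^sup>*\<close> is killed by \<open>M\<^sup>*\<close>.

  For binormal \<open>T\<close> put \<open>Q = V P V\<^sup>*\<close>, which is the positive square root of \<open>T T\<^sup>*\<close>. It has the kernel of
  \<open>V\<^sup>*\<close> and satisfies \<open>V\<^sup>* Q = P V\<^sup>*\<close>, so \<open>2 M\<^sup>* = V\<^sup>* (Q + P)\<close> and \<open>ker M\<^sup>* = ker (Q\<^sup>2 + Q P)\<close>. Binormality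
  says that \<open>P\<^sup>2\<close> and \<open>Q\<^sup>2\<close> commute; then \<open>P\<close> and \<open>Q\<close> commute, hence \<open>Q P \<ge> 0\<close>. So \<open>(Q\<^sup>2 + Q P) x = 0\<close>
  forces \<open>\<langle>Q\<^sup>2 x, x\<rangle> \<le> 0\<close>, i.e. \<open>Q x = 0\<close>; and if \<open>Q x = 0\<close> then \<open>Q P x = P Q x = 0\<close> as well.

  This rests on three existence and uniqueness results. Adjoints come from the Riesz representation
  theorem (\<open>riesz_representation\<close>). The square root of a positive operator comes from a fixed-point
  iteration (\<open>contraction_sqrt_iteration\<close>), which also shows that it commutes with everything that
  commutes with the operator (\<open>positive_selfadjoint_sqrt\<close>); uniqueness, the passage from \<open>P\<^sup>2\<close>, \<open>Q\<^sup>2\<close>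
  to \<open>P\<close>, \<open>Q\<close>, and the positivity of \<open>Q P\<close> are consequences of this commutation property.
  Uniqueness of the polar factor (\<open>polar_factor_unique\<close>) identifies \<open>V\<close> in the definition of \<open>M\<close>.

  The analysis is carried out for the real inner product \<open>Re \<langle>x, y\<rangle>\<close>. Nothing is lost: real and complex
  adjoints of complex-linear maps coincide, and complex linearity of a square root is its commutation
  with the multiplications by complex scalars.
\<close>

section \<open>Riesz representation and adjoints\<close>

instance chilbert_space \<subseteq> banach ..

lemma inner_right_cancel:
  fixes y z :: "'a::real_inner"
  assumes "\<And>x. inner x y = inner x z"
  shows "y = z"
proof -
  have "inner (y - z) (y - z) = 0"
    using assms[of "y - z"] by (simp add: inner_diff_right)
  then show ?thesis by simp
qed

text \<open>
  The representing vector is the minimizer of \<open>J x = \<parallel>x\<parallel>\<^sup>2 - 2 f x\<close>, which equals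
  \<open>\<parallel>x - y\<parallel>\<^sup>2 - \<parallel>y\<parallel>\<^sup>2\<close> if \<open>y\<close> represents \<open>f\<close>. A minimizing sequence is Cauchy by the parallelogram law,
  and stationarity of \<open>J\<close> at its limit \<open>y\<close> is the equation \<open>f x = \<langle>x, y\<rangle>\<close>.
\<close>

lemma riesz_representation:
  fixes f :: "'a::{real_inner,complete_space} \<Rightarrow> real"
  assumes f: "bounded_linear f"
  shows "\<exists>y. \<forall>x. f x = inner x y"
proof -
  interpret f: bounded_linear f by fact
  define J where "J x = (norm x)\<^sup>2 - 2 * f x" for x
  obtain c where c: "\<And>x. norm (f x) \<le> norm x * c" "c \<ge> 0"
    using f.nonneg_bounded by blast
  have J_ge: "J x \<ge> - (c\<^sup>2)" for x
  proof -
    have "0 \<le> (norm x - c)\<^sup>2" by simp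
    then show ?thesis
      using c(1)[of x] by (simp add: J_def power2_eq_square algebra_simps abs_le_iff)
  qed
  define m where "m = Inf (range J)"
  have bdd: "bdd_below (range J)"
    using J_ge by (intro bdd_belowI2[where m = "- (c\<^sup>2)"])
  have m_le: "m \<le> J x" for x
    unfolding m_def by (rule cInf_lower[OF _ bdd]) simp
  have "\<exists>x. J x < m + 1 / Suc n" for n
  proof -
    have "Inf (range J) < m + 1 / Suc n" by (simp add: m_def)
    then show ?thesis using cInf_lessD[of "range J"] by blast
  qed
  then obtain s where s: "\<And>n. J (s n) < m + 1 / Suc n" by metis
  have parallelogram: "(dist a b)\<^sup>2 \<le> 2 * (J a - m) + 2 * (J b - m)" for a b
  proof -
    have "(dist a b)\<^sup>2 = 2 * J a + 2 * J b - 4 * J ((1/2) *\<^sub>R (a + b))"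
      unfolding J_def dist_norm power2_norm_eq_inner
      by (simp add: f.add f.scaleR inner_diff_left inner_diff_right inner_add_left inner_add_right
          inner_commute algebra_simps)
    then show ?thesis using m_le[of "(1/2) *\<^sub>R (a + b)"] by simp
  qed
  have "Cauchy s"
  proof (rule metric_CauchyI)
    fix e :: real assume "e > 0"
    then obtain N where N: "1 / Suc N < e\<^sup>2 / 4"
      using nat_approx_posE[of "e\<^sup>2 / 4"] by auto
    show "\<exists>N. \<forall>k\<ge>N. \<forall>l\<ge>N. dist (s k) (s l) < e"
    proof (intro exI allI impI)
      fix k l assume "k \<ge> N" "l \<ge> N"
      then have "1 / real (Suc k) \<le> 1 / Suc N" "1 / real (Suc l) \<le> 1 / Suc N"
        by (simp_all add: frac_le)
      then have "J (s k) - m < e\<^sup>2 / 4" "J (s l) - m < e\<^sup>2 / 4"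
        using s[of k] s[of l] N by linarith+
      then have "(dist (s k) (s l))\<^sup>2 < e\<^sup>2"
        using parallelogram[of "s k" "s l"] by argo
      then show "dist (s k) (s l) < e"
        using \<open>e > 0\<close> by (meson less_imp_le power_less_imp_less_base)
    qed
  qed
  then obtain y where y: "s \<longlonglongrightarrow> y"
    using Cauchy_convergent convergentD by blast
  have "(\<lambda>n. J (s n)) \<longlonglongrightarrow> J y"
    unfolding J_def by (intro tendsto_intros f.tendsto y)
  moreover have "(\<lambda>n. m + 1 / Suc n) \<longlonglongrightarrow> m + 0"
    by (intro tendsto_add tendsto_const LIMSEQ_Suc lim_1_over_n)
  ultimately have "J y \<le> m + 0"
    using s by (intro LIMSEQ_le[of "\<lambda>n. J (s n)" _ "\<lambda>n. m + 1 / Suc n"]) (auto intro: less_imp_le)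
  then have minimal: "J y \<le> J x" for x
    using m_le[of x] by simp
  have "f x = inner x y" for x
  proof (cases "x = 0")
    case True
    then show ?thesis by (simp add: f.zero)
  next
    case False
    define d where "d = f x - inner x y"
    \<comment> \<open>The step \<open>t\<close> minimizes the quadratic \<open>t \<mapsto> J (y + t x) = J y + t\<^sup>2 \<parallel>x\<parallel>\<^sup>2 - 2 t d\<close>.\<close>
    define t where "t = d / (norm x)\<^sup>2"
    have "J (y + t *\<^sub>R x) = J y + t\<^sup>2 * (norm x)\<^sup>2 - 2 * t * d"
      unfolding J_def d_def power2_norm_eq_inner
      by (simp add: f.add f.scaleR inner_add_left inner_add_right inner_commute
          power2_eq_square algebra_simps)
    moreover have "t\<^sup>2 * (norm x)\<^sup>2 = t * d"
      using False by (simp add: t_def power2_eq_square)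
    ultimately have "t * d \<le> 0"
      using minimal[of "y + t *\<^sub>R x"] by argo
    then have "d * d / (norm x)\<^sup>2 \<le> 0"
      by (simp add: t_def)
    moreover have "(norm x)\<^sup>2 > 0" using False by simp
    ultimately have "d * d \<le> 0" by (simp add: divide_le_0_iff)
    then show ?thesis by (auto simp: d_def mult_le_0_iff)
  qed
  then show ?thesis by blast
qed

lemma adjoint_exists:
  fixes T :: "'a::{real_inner,complete_space} \<Rightarrow> 'b::real_inner"
  assumes T: "bounded_linear T"
  shows "\<exists>S. bounded_linear S \<and> (\<forall>x y. inner (T x) y = inner x (S y))"
proof -
  interpret T: bounded_linear T by fact
  have "\<exists>z. \<forall>x. inner (T x) y = inner x z" for y
    by (rule riesz_representation) (rule bounded_linear_compose[OF bounded_linear_inner_left T])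
  then obtain S where S: "\<And>x y. inner (T x) y = inner x (S y)" by metis
  obtain c where c: "\<And>x. norm (T x) \<le> norm x * c" "c \<ge> 0"
    using T.nonneg_bounded by blast
  have "bounded_linear S"
  proof (rule bounded_linear_intro)
    show "S (y + z) = S y + S z" for y z
      by (rule inner_right_cancel) (simp add: inner_add_right flip: S)
    show "S (r *\<^sub>R y) = r *\<^sub>R S y" for r y
      by (rule inner_right_cancel) (simp flip: S)
    show "norm (S y) \<le> norm y * c" for y
    proof -
      have "norm (S y) * norm (S y) = inner (T (S y)) y"
        by (simp add: S power2_norm_eq_inner flip: power2_eq_square)
      also have "\<dots> \<le> norm (T (S y)) * norm y" by (rule norm_cauchy_schwarz)
      also have "\<dots> \<le> norm (S y) * (norm y * c)"
        using mult_right_mono[OF c(1)[of "S y"] norm_ge_zero[of y]] by (simp add: ac_simps)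
      finally show ?thesis
        using c(2) by (cases "norm (S y) = 0") auto
    qed
  qed
  with S show ?thesis by blast
qed

section \<open>Square roots of positive operators\<close>

text \<open>
  The equation \<open>2 Y = K + Y\<^sup>2\<close> says that \<open>(1 - Y)\<^sup>2 = 1 - K\<close>. It is solved by iterating
  \<open>Z \<mapsto> (K + Z\<^sup>2) / 2\<close> from \<open>0\<close>. The iterates converge in norm, even for \<open>\<parallel>K\<parallel> = 1\<close>, because their norms
  and their increments are majorized by those of the scalar iteration \<open>r \<mapsto> (1 + r\<^sup>2) / 2\<close>, which
  increases and stays below its fixed point \<open>1\<close>. The last conjunct transfers to \<open>Y\<close> every closed
  property that the iteration preserves, such as symmetry or commutation with a given operator.
\<close>

lemma contraction_sqrt_iteration:
  fixes K :: "'a::banach \<Rightarrow>\<^sub>L 'a"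
  assumes K: "norm K \<le> 1"
  shows "\<exists>Y. norm Y \<le> 1 \<and> 2 *\<^sub>R Y = K + (Y o\<^sub>L Y) \<and>
    (\<forall>C. closed C \<longrightarrow> 0 \<in> C \<longrightarrow> (\<forall>Z\<in>C. (1/2) *\<^sub>R (K + (Z o\<^sub>L Z)) \<in> C) \<longrightarrow> Y \<in> C)"
proof -
  define F where "F Z = (1/2) *\<^sub>R (K + (Z o\<^sub>L Z))" for Z
  define Y where "Y n = (F ^^ n) 0" for n
  define y :: "nat \<Rightarrow> real" where "y n = ((\<lambda>r. (1 + r\<^sup>2) / 2) ^^ n) 0" for n
  have Y_simps: "Y 0 = 0" "Y (Suc n) = (1/2) *\<^sub>R (K + (Y n o\<^sub>L Y n))" for n
    by (simp_all add: Y_def F_def)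
  have y_simps: "y 0 = 0" "y (Suc n) = (1 + (y n)\<^sup>2) / 2" for n
    by (simp_all add: y_def)
  have y_bounds: "0 \<le> y n \<and> y n \<le> 1" for n
    by (induction n) (auto simp: y_simps power_le_one)
  have y_mono: "y n \<le> y (Suc n)" for n
  proof -
    have "0 \<le> (1 - y n)\<^sup>2" by simp
    then show ?thesis by (simp add: y_simps power2_eq_square algebra_simps)
  qed
  have Y_norm: "norm (Y n) \<le> y n" for n
  proof (induction n)
    case (Suc n)
    have "norm (Y n o\<^sub>L Y n) \<le> (y n)\<^sup>2"
      using norm_blinfun_compose[of "Y n" "Y n"] mult_mono[OF Suc Suc] y_bounds[of n]
      by (simp add: power2_eq_square)
    then show ?case
      using norm_triangle_ineq[of K "Y n o\<^sub>L Y n"] K by (simp add: Y_simps y_simps)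
  qed (simp add: Y_simps y_simps)
  have step: "norm (Y (Suc n) - Y n) \<le> y (Suc n) - y n" for n
  proof (induction n)
    case 0
    show ?case using K by (simp add: Y_simps y_simps)
  next
    case (Suc n)
    let ?D = "Y (Suc n) - Y n" and ?d = "y (Suc n) - y n"
    \<comment> \<open>The identity \<open>A\<^sup>2 - B\<^sup>2 = A (A - B) + (A - B) B\<close>.\<close>
    have eq: "Y (Suc (Suc n)) - Y (Suc n) = (1/2) *\<^sub>R ((Y (Suc n) o\<^sub>L ?D) + (?D o\<^sub>L Y n))"
      unfolding Y_simps(2)[of "Suc n"]
      by (subst Y_simps(2)[of n], rule blinfun_eqI)
        (simp add: blinfun.bilinear_simps algebra_simps)
    have "norm (Y (Suc n) o\<^sub>L ?D) \<le> y (Suc n) * ?d"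
      using norm_blinfun_compose[of "Y (Suc n)" ?D] mult_mono[OF Y_norm[of "Suc n"] Suc] y_bounds
      by (meson norm_ge_zero order_trans)
    moreover have "norm (?D o\<^sub>L Y n) \<le> ?d * y n"
      using norm_blinfun_compose[of ?D "Y n"] mult_mono[OF Suc Y_norm[of n]] y_mono[of n]
      by (smt (verit) norm_ge_zero)
    ultimately have "norm (Y (Suc (Suc n)) - Y (Suc n)) \<le> (y (Suc n) * ?d + ?d * y n) / 2"
      unfolding eq using norm_triangle_ineq[of "Y (Suc n) o\<^sub>L ?D" "?D o\<^sub>L Y n"] by simp
    also have "\<dots> = y (Suc (Suc n)) - y (Suc n)"
      unfolding y_simps(2)[of "Suc n"] by (subst (4) y_simps(2)) (simp add: power2_eq_square field_simps)
    finally show ?case .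
  qed
  have "summable (\<lambda>n. y (Suc n) - y n)"
  proof (rule summableI_nonneg_bounded)
    show "(\<Sum>i<n. y (Suc i) - y i) \<le> 1" for n
      unfolding sum_lessThan_telescope using y_bounds[of n] by (simp add: y_simps(1))
  qed (use y_mono in simp)
  then have "summable (\<lambda>n. Y (Suc n) - Y n)"
    by (rule summable_comparison_test'[where N = 0]) (rule step)
  then have "convergent (\<lambda>n. \<Sum>i<n. Y (Suc i) - Y i)"
    by (simp add: summable_iff_convergent)
  then obtain L where L: "Y \<longlonglongrightarrow> L"
    unfolding sum_lessThan_telescope by (auto simp: Y_simps(1) convergent_def)
  have "norm L \<le> 1"
    by (rule LIMSEQ_le_const2[OF tendsto_norm[OF L]])
      (use Y_norm y_bounds in \<open>auto intro: order_trans\<close>)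
  moreover have "2 *\<^sub>R L = K + (L o\<^sub>L L)"
  proof -
    have "(\<lambda>n. Y (Suc n)) \<longlonglongrightarrow> (1/2) *\<^sub>R (K + (L o\<^sub>L L))"
      unfolding Y_simps
      by (intro tendsto_intros bounded_bilinear.tendsto[OF bounded_bilinear_blinfun_compose] L)
    then have "L = (1/2) *\<^sub>R (K + (L o\<^sub>L L))"
      using LIMSEQ_unique LIMSEQ_Suc[OF L] by blast
    then show ?thesis by (metis scaleR_half_double scaleR_2 scaleR_right_distrib)
  qed
  moreover have "L \<in> C" if "closed C" "0 \<in> C" "\<forall>Z\<in>C. (1/2) *\<^sub>R (K + (Z o\<^sub>L Z)) \<in> C" for C
  proof -
    have "Y n \<in> C" for n
      by (induction n) (use that in \<open>auto simp: Y_simps\<close>)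
    then show ?thesis using closed_sequentially[OF that(1) _ L] by blast
  qed
  ultimately show ?thesis by blast
qed

text \<open>
  Over the reals symmetry does not follow from nonnegativity of the quadratic form, so it is part of
  the definition; \<open>positive_op_iff\<close> relates this notion to positivity of complex operators.
\<close>

definition positive_selfadjoint :: "('a::real_inner \<Rightarrow> 'a) \<Rightarrow> bool" where
  "positive_selfadjoint A \<longleftrightarrow> bounded_linear A
     \<and> (\<forall>x y. inner (A x) y = inner x (A y)) \<and> (\<forall>x. 0 \<le> inner (A x) x)"

text \<open>
  The operator inequality \<open>A\<^sup>2 \<le> A\<close> for \<open>0 \<le> A \<le> 1\<close>, obtained from positivity of the form
  at the vector \<open>x - A x\<close>. It implies \<open>\<parallel>1 - A\<parallel> \<le> 1\<close>, the hypothesis of the iteration.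
\<close>

lemma positive_contraction_ge_square:
  assumes A: "positive_selfadjoint A" and contr: "\<And>x. norm (A x) \<le> norm x"
  shows "(norm (A x))\<^sup>2 \<le> inner (A x) x"
proof -
  interpret A: bounded_linear A using A by (simp add: positive_selfadjoint_def)
  have sym: "inner (A u) v = inner u (A v)" for u v
    using A by (simp add: positive_selfadjoint_def)
  have "0 \<le> inner (A (x - A x)) (x - A x)"
    using A unfolding positive_selfadjoint_def by blast
  also have "\<dots> = inner (A x) x - 2 * (norm (A x))\<^sup>2 + inner (A (A x)) (A x)"
    by (simp add: A.diff inner_diff_left inner_diff_right power2_norm_eq_inner sym[of "A x" x])
  also have "inner (A (A x)) (A x) \<le> norm (A (A x)) * norm (A x)"
    by (rule norm_cauchy_schwarz)
  also have "\<dots> \<le> norm (A x) * norm (A x)"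
    by (intro mult_right_mono contr) simp
  finally show ?thesis by (simp add: power2_eq_square)
qed

text \<open>
  After scaling to a contraction \<open>h = A / c\<close>, the iteration for \<open>K = 1 - h\<close> yields \<open>Y\<close> with
  \<open>(1 - Y)\<^sup>2 = h\<close>, and \<open>\<parallel>Y\<parallel> \<le> 1\<close> makes \<open>1 - Y\<close> positive. The root is \<open>B = \<surd>c (1 - Y)\<close>. Commutation is
  asserted for all bounded real-linear \<open>S\<close>, so that it covers multiplication by complex scalars.
\<close>

lemma positive_selfadjoint_sqrt:
  fixes A :: "'a::{real_inner,banach} \<Rightarrow> 'a"
  assumes A: "positive_selfadjoint A"
  shows "\<exists>B. positive_selfadjoint B \<and> B \<circ> B = A \<and>
    (\<forall>S. bounded_linear S \<longrightarrow> S \<circ> A = A \<circ> S \<longrightarrow> S \<circ> B = B \<circ> S)"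
proof -
  interpret A: bounded_linear A using A by (simp add: positive_selfadjoint_def)
  have sym: "inner (A u) v = inner u (A v)" and pos: "0 \<le> inner (A u) u" for u v
    using A unfolding positive_selfadjoint_def by blast+
  obtain c where c: "c > 0" "\<And>x. norm (A x) \<le> norm x * c"
    using A.pos_bounded by blast
  define h where "h x = (1/c) *\<^sub>R A x" for x
  have bl_h: "bounded_linear h"
    unfolding h_def by (intro bounded_linear_intros A.bounded_linear_axioms)
  have h_pos: "positive_selfadjoint h"
    using bl_h c(1) pos by (auto simp: positive_selfadjoint_def h_def sym)
  have h_contr: "norm (h x) \<le> norm x" for x
    using c by (simp add: h_def field_simps)
  define K where "K = id_blinfun - Blinfun h"
  have K: "blinfun_apply K x = x - h x" for x
    by (simp add: K_def blinfun.bilinear_simps bounded_linear_Blinfun_apply bl_h)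
  have "norm (K x) \<le> 1 * norm x" for x
  proof (rule power2_le_imp_le)
    have "(norm (h x))\<^sup>2 \<le> inner (h x) x" "0 \<le> inner (h x) x"
      using positive_contraction_ge_square[OF h_pos h_contr] h_pos
      by (auto simp: positive_selfadjoint_def)
    then show "(norm (K x))\<^sup>2 \<le> (1 * norm x)\<^sup>2"
      by (simp add: K power2_norm_eq_inner inner_diff_left inner_diff_right inner_commute)
  qed simp
  then have "norm K \<le> 1" by (intro norm_blinfun_bound) auto
  then obtain Y where Y: "norm Y \<le> 1" "2 *\<^sub>R Y = K + (Y o\<^sub>L Y)"
    and Y_in: "\<And>C. closed C \<Longrightarrow> 0 \<in> C \<Longrightarrow>
      (\<And>Z. Z \<in> C \<Longrightarrow> (1/2) *\<^sub>R (K + (Z o\<^sub>L Z)) \<in> C) \<Longrightarrow> Y \<in> C"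
    using contraction_sqrt_iteration[of K] by metis
  define B where "B x = sqrt c *\<^sub>R (x - Y x)" for x
  have bl_B: "bounded_linear B"
    unfolding B_def by (intro bounded_linear_intros)
  \<comment> \<open>Symmetry, and below commutation with \<open>S\<close>, are closed conditions preserved by the iteration.\<close>
  have Y_sym: "inner (Y x) y = inner x (Y y)" for x y
  proof -
    have "Y \<in> {Z. \<forall>x y. inner (blinfun_apply Z x) y = inner x (blinfun_apply Z y)}"
    proof (rule Y_in)
      show "closed {Z. \<forall>x y. inner (blinfun_apply Z x) y = inner x (blinfun_apply Z y)}"
        by (intro closed_Collect_all closed_Collect_eq continuous_intros)
    next
      fix Z :: "'a \<Rightarrow>\<^sub>L 'a" assume "Z \<in> {Z. \<forall>x y. inner (blinfun_apply Z x) y = inner x (blinfun_apply Z y)}"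
      moreover have "inner (h x) y = inner x (h y)" for x y
        using h_pos by (simp add: positive_selfadjoint_def)
      ultimately show "(1/2) *\<^sub>R (K + (Z o\<^sub>L Z)) \<in>
          {Z. \<forall>x y. inner (blinfun_apply Z x) y = inner x (blinfun_apply Z y)}"
        by (simp add: blinfun.bilinear_simps K inner_diff_left inner_diff_right
            inner_add_left inner_add_right)
    qed simp
    then show ?thesis by simp
  qed
  have "positive_selfadjoint B"
    unfolding positive_selfadjoint_def
  proof (intro conjI allI bl_B)
    show "inner (B x) y = inner x (B y)" for x y
      by (simp add: B_def inner_diff_left inner_diff_right Y_sym)
    have "inner (Y x) x \<le> inner x x" for x
    proof -
      have "inner (Y x) x \<le> norm (Y x) * norm x" by (rule norm_cauchy_schwarz)
      also have "norm (Y x) \<le> 1 * norm x"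
        using norm_blinfun[of Y x] mult_right_mono[OF Y(1) norm_ge_zero[of x]] by linarith
      finally show ?thesis by (simp add: dot_square_norm power2_eq_square mult_right_mono)
    qed
    then show "0 \<le> inner (B x) x" for x
      using c(1) by (simp add: B_def inner_diff_left)
  qed
  moreover have "B \<circ> B = A"
  proof
    fix x
    have "2 *\<^sub>R Y x = (x - h x) + Y (Y x)"
      using arg_cong[OF Y(2), of "\<lambda>Z. blinfun_apply Z x"] by (simp add: blinfun.bilinear_simps K)
    moreover have "(B \<circ> B) x = c *\<^sub>R (x - 2 *\<^sub>R Y x + Y (Y x))"
      using c(1) by (simp add: B_def blinfun.bilinear_simps scaleR_2 algebra_simps)
    ultimately show "(B \<circ> B) x = A x"
      using c(1) by (simp add: h_def)
  qed
  moreover have "S \<circ> B = B \<circ> S" if S: "bounded_linear S" "S \<circ> A = A \<circ> S" for S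
  proof -
    interpret S: bounded_linear S by fact
    have SA: "S (A x) = A (S x)" for x using S(2) by (metis comp_apply)
    have "Y \<in> {Z. \<forall>x. S (blinfun_apply Z x) = blinfun_apply Z (S x)}"
    proof (rule Y_in)
      show "closed {Z. \<forall>x. S (blinfun_apply Z x) = blinfun_apply Z (S x)}"
        by (intro closed_Collect_all closed_Collect_eq continuous_intros S.continuous_on)
    next
      fix Z :: "'a \<Rightarrow>\<^sub>L 'a" assume "Z \<in> {Z. \<forall>x. S (blinfun_apply Z x) = blinfun_apply Z (S x)}"
      then show "(1/2) *\<^sub>R (K + (Z o\<^sub>L Z)) \<in>
          {Z. \<forall>x. S (blinfun_apply Z x) = blinfun_apply Z (S x)}"
        by (simp add: blinfun.bilinear_simps K S.add S.diff S.scaleR h_def SA)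
    qed (simp add: S.zero)
    then show ?thesis
      by (auto simp: B_def S.diff S.scaleR)
  qed
  ultimately show ?thesis by blast
qed

text \<open>
  If \<open>B\<close> is a square root of \<open>A\<close>, then \<open>\<langle>A x, x\<rangle> = \<parallel>B x\<parallel>\<^sup>2\<close> and \<open>A x = B (B x)\<close>.
\<close>

lemma positive_selfadjoint_kernel:
  fixes A :: "'a::{real_inner,banach} \<Rightarrow> 'a"
  assumes A: "positive_selfadjoint A" and x: "inner (A x) x = 0"
  shows "A x = 0"
proof -
  obtain B where B: "positive_selfadjoint B" "B \<circ> B = A"
    using positive_selfadjoint_sqrt[OF A] by blast
  interpret B: bounded_linear B using B(1) by (simp add: positive_selfadjoint_def)
  have "inner (B x) (B x) = inner (B (B x)) x"
    using B(1) by (simp add: positive_selfadjoint_def)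
  also have "\<dots> = 0" using x by (simp flip: B(2))
  finally have "B x = 0" by simp
  then show ?thesis by (simp add: B.zero flip: B(2))
qed

text \<open>
  For \<open>y = (B - C) x\<close> commutation gives \<open>(B + C) y = (B\<^sup>2 - C\<^sup>2) x = 0\<close>. Positivity then gives
  \<open>B y = C y = 0\<close>, whence \<open>\<parallel>y\<parallel>\<^sup>2 = \<langle>x, (B - C) y\<rangle> = 0\<close>.
\<close>

lemma commuting_positive_sqrt_unique:
  fixes B C :: "'a::{real_inner,banach} \<Rightarrow> 'a"
  assumes B: "positive_selfadjoint B" and C: "positive_selfadjoint C"
    and comm: "B \<circ> C = C \<circ> B" and sq: "B \<circ> B = C \<circ> C"
  shows "B = C"
proof
  fix x
  interpret B: bounded_linear B using B by (simp add: positive_selfadjoint_def)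
  interpret C: bounded_linear C using C by (simp add: positive_selfadjoint_def)
  have BC: "B (C z) = C (B z)" and BB: "B (B z) = C (C z)" for z
    using comm sq by (metis comp_apply)+
  define y where "y = B x - C x"
  have "B y + C y = 0"
    by (simp add: y_def B.diff C.diff BC BB)
  then have "inner (B y) y + inner (C y) y = 0"
    by (simp flip: inner_add_left)
  moreover have "inner (B y) y \<ge> 0" "inner (C y) y \<ge> 0"
    using B C unfolding positive_selfadjoint_def by blast+
  ultimately have "inner (B y) y = 0" "inner (C y) y = 0" by linarith+
  then have "B y = 0" "C y = 0"
    using positive_selfadjoint_kernel B C by blast+
  moreover have "inner y y = inner x (B y) - inner x (C y)"
    using B C unfolding positive_selfadjoint_def
    by (subst y_def) (simp add: inner_diff_left)
  ultimately have "inner y y = 0" by simp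
  then show "B x = C x" by (simp add: y_def)
qed

text \<open>
  The square root \<open>R\<close> of \<open>Q\<close> commutes with \<open>P\<close>, so \<open>\<langle>Q P x, x\<rangle> = \<langle>P R x, R x\<rangle>\<close>.
\<close>

lemma commuting_positive_product_nonneg:
  fixes P Q :: "'a::{real_inner,banach} \<Rightarrow> 'a"
  assumes P: "positive_selfadjoint P" and Q: "positive_selfadjoint Q" and comm: "P \<circ> Q = Q \<circ> P"
  shows "0 \<le> inner (Q (P x)) x"
proof -
  have "bounded_linear P" using P by (simp add: positive_selfadjoint_def)
  then obtain R where R: "positive_selfadjoint R" "R \<circ> R = Q" "P \<circ> R = R \<circ> P"
    using positive_selfadjoint_sqrt[OF Q] comm by blast
  have "inner (Q (P x)) x = inner (R (P x)) (R x)"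
    using R(1) unfolding positive_selfadjoint_def by (metis R(2) comp_apply)
  also have "\<dots> = inner (P (R x)) (R x)" using R(3) by (metis comp_apply)
  also have "\<dots> \<ge> 0" using P unfolding positive_selfadjoint_def by blast
  finally show ?thesis .
qed

section \<open>From real to complex operators\<close>

lemma inner_scaleC_left:
  fixes x y :: "'a::complex_inner"
  shows "inner (a *\<^sub>C x) y = inner x (cnj a *\<^sub>C y)"
proof -
  have "cinner x (cnj a *\<^sub>C y) = a * cinner x y"
    using cinner_commute[of x "cnj a *\<^sub>C y"] cinner_commute[of x y] by (simp add: cinner_scaleC_left)
  then show ?thesis by (simp add: cinner_scaleC_left flip: Re_cinner)
qed

lemma scaleC_one: "1 *\<^sub>C x = (x::'a::complex_inner)"
  using scaleC_of_real[of 1 x] by simp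

lemma cinner_eq_Complex:
  fixes x y :: "'a::complex_inner"
  shows "cinner x y = Complex (inner x y) (inner x (\<i> *\<^sub>C y))"
  using inner_scaleC_left[of "- \<i>" x y]
  by (simp add: complex_eq_iff cinner_scaleC_left flip: Re_cinner)

lemma bounded_linear_scaleC: "bounded_linear (\<lambda>x::'a::complex_inner. a *\<^sub>C x)"
proof (rule bounded_linear_intro)
  fix x y :: 'a and r :: real
  show "a *\<^sub>C (x + y) = a *\<^sub>C x + a *\<^sub>C y" by (rule scaleC_add_right)
  show "a *\<^sub>C (r *\<^sub>R x) = r *\<^sub>R (a *\<^sub>C x)"
    by (simp only: scaleC_scaleC mult.commute flip: scaleC_of_real)
  have "cnj a * a = complex_of_real ((cmod a)\<^sup>2)"
    by (subst complex_norm_square) (rule mult.commute)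
  then have "inner (a *\<^sub>C x) (a *\<^sub>C x) = (cmod a)\<^sup>2 * inner x x"
    by (simp only: inner_scaleC_left scaleC_scaleC scaleC_of_real inner_scaleR_right)
  then show "norm (a *\<^sub>C x) \<le> norm x * cmod a"
    by (simp add: norm_eq_sqrt_inner real_sqrt_mult)
qed

lemma bounded_clinear_linear: "bounded_clinear T \<Longrightarrow> bounded_linear T"
  by (simp add: bounded_clinear_def)

lemma bounded_clinear_comp: "bounded_clinear S \<Longrightarrow> bounded_clinear T \<Longrightarrow> bounded_clinear (S \<circ> T)"
  by (simp add: bounded_clinear_def bounded_linear_compose[of S T] comp_def)

text \<open>
  The real adjoint of a complex-linear map is complex-linear, and \<open>cinner\<close> is determined by its real
  part, so the real adjoint is also the complex one.
\<close>

lemma ex1_complex_adjoint: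
  fixes T :: "'a::chilbert_space \<Rightarrow> 'b::complex_inner"
  assumes T: "bounded_clinear T"
  shows "\<exists>!S. bounded_clinear S \<and> (\<forall>x y. cinner (T x) y = cinner x (S y))"
proof (rule ex_ex1I)
  obtain S where S: "bounded_linear S" "\<And>x y. inner (T x) y = inner x (S y)"
    using adjoint_exists[OF bounded_clinear_linear[OF T]] by blast
  have scaleC: "S (c *\<^sub>C y) = c *\<^sub>C S y" for c y
  proof (rule inner_right_cancel)
    fix x
    have "inner x (S (c *\<^sub>C y)) = inner (cnj c *\<^sub>C T x) y"
      by (simp add: inner_scaleC_left flip: S(2))
    also have "\<dots> = inner (T (cnj c *\<^sub>C x)) y"
      using T by (simp add: bounded_clinear_def)
    also have "\<dots> = inner x (c *\<^sub>C S y)"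
      by (simp add: S(2) inner_scaleC_left)
    finally show "inner x (S (c *\<^sub>C y)) = inner x (c *\<^sub>C S y)" .
  qed
  then have "bounded_clinear S"
    using S(1) by (simp add: bounded_clinear_def)
  moreover have "cinner (T x) y = cinner x (S y)" for x y
    by (simp add: cinner_eq_Complex S(2) scaleC)
  ultimately show "\<exists>S. bounded_clinear S \<and> (\<forall>x y. cinner (T x) y = cinner x (S y))"
    by blast
next
  fix S R assume S: "bounded_clinear S \<and> (\<forall>x y. cinner (T x) y = cinner x (S y))"
    and R: "bounded_clinear R \<and> (\<forall>x y. cinner (T x) y = cinner x (R y))"
  have "cinner x (S y) = cinner x (R y)" for x y
    using S[THEN conjunct2, rule_format, of x y] R[THEN conjunct2, rule_format, of x y]
    by (rule trans[OF sym])
  then have "inner x (S y) = inner x (R y)" for x y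
    by (simp only: Re_cinner[symmetric])
  then show "S = R"
    using inner_right_cancel by blast
qed

lemma cadjoint:
  fixes T :: "'a::chilbert_space \<Rightarrow> 'b::complex_inner"
  assumes "bounded_clinear T"
  shows bounded_clinear_cadjoint: "bounded_clinear (cadjoint T)"
    and inner_cadjoint: "inner (T x) y = inner x (cadjoint T y)"
proof -
  have adj: "bounded_clinear (cadjoint T) \<and> (\<forall>x y. cinner (T x) y = cinner x (cadjoint T y))"
    unfolding cadjoint_def by (rule theI'[OF ex1_complex_adjoint[OF assms]])
  then show "bounded_clinear (cadjoint T)" by blast
  show "inner (T x) y = inner x (cadjoint T y)"
    unfolding Re_cinner[symmetric] by (rule arg_cong[OF adj[THEN conjunct2, rule_format]])
qed

lemma cadjoint_eqI:
  fixes T :: "'a::chilbert_space \<Rightarrow> 'b::complex_inner"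
  assumes "bounded_clinear T" and "\<And>x y. inner (T x) y = inner x (S y)"
  shows "cadjoint T = S"
  by (rule ext, rule inner_right_cancel) (rule trans[OF inner_cadjoint[OF assms(1), symmetric] assms(2)])

text \<open>
  A complex operator with real quadratic form is symmetric: since the form \<open>\<langle>A x, i x\<rangle>\<close> vanishes
  identically, so does its polarization, and replacing \<open>x\<close> by \<open>i x\<close> there gives
  \<open>\<langle>A x, y\<rangle> = \<langle>x, A y\<rangle>\<close>.
\<close>

lemma positive_op_iff:
  "positive_op A \<longleftrightarrow> bounded_clinear A \<and> positive_selfadjoint A"
proof (cases "bounded_clinear A")
  case False
  then show ?thesis by (simp add: positive_op_def)
next
  case True
  interpret A: bounded_linear A by (rule bounded_clinear_linear[OF True])
  have scaleC: "A (c *\<^sub>C x) = c *\<^sub>C A x" for c x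
    using True by (simp add: bounded_clinear_def)
  have minus: "(- 1) *\<^sub>C x = - x" for x :: 'a
    using scaleC_of_real[of "- 1" x] by simp
  have minus_i: "(- \<i>) *\<^sub>C x = - (\<i> *\<^sub>C x)" for x :: 'a
    using scaleC_scaleC[of "- 1" "\<i>" x] by (simp add: minus)
  have cinner: "cinner (A x) x \<in> \<real>\<^sub>\<ge>\<^sub>0 \<longleftrightarrow> inner (A x) x \<ge> 0 \<and> inner (A x) (\<i> *\<^sub>C x) = 0" for x
    by (simp add: cinner_eq_Complex complex_nonneg_Reals_iff)
  show ?thesis
  proof
    assume "positive_op A"
    then have nonneg: "inner (A x) x \<ge> 0" and im: "inner (A x) (\<i> *\<^sub>C x) = 0" for x
      by (simp_all add: positive_op_def cinner)
    have polarized: "inner (A x) (\<i> *\<^sub>C y) + inner (A y) (\<i> *\<^sub>C x) = 0" for x y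
      using im[of "x + y"] im[of x] im[of y]
      by (simp add: A.add scaleC_add_right inner_add_left inner_add_right)
    have "inner (A x) y = inner x (A y)" for x y
      using polarized[of "\<i> *\<^sub>C x" y]
      by (simp add: scaleC inner_scaleC_left scaleC_scaleC scaleC_one minus inner_commute[of x])
    then show "bounded_clinear A \<and> positive_selfadjoint A"
      using True A.bounded_linear_axioms nonneg by (simp add: positive_selfadjoint_def)
  next
    assume "bounded_clinear A \<and> positive_selfadjoint A"
    then have sym: "inner (A x) y = inner x (A y)" and nonneg: "0 \<le> inner (A x) x" for x y
      unfolding positive_selfadjoint_def by blast+
    have "inner (A x) (\<i> *\<^sub>C x) = - inner (A x) (\<i> *\<^sub>C x)" for x
      using inner_scaleC_left[of "- \<i>" "A x" x] sym[of x "\<i> *\<^sub>C x"]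
      by (simp add: scaleC minus_i inner_commute)
    then show "positive_op A" using True nonneg by (simp add: positive_op_def cinner)
  qed
qed

text \<open>
  The real square root is complex-linear because it commutes with multiplication by complex scalars,
  as \<open>A\<close> does.
\<close>

lemma positive_op_sqrt_exists:
  fixes A :: "'a::chilbert_space \<Rightarrow> 'a"
  assumes A: "positive_op A"
  shows "\<exists>B. positive_op B \<and> B \<circ> B = A \<and>
    (\<forall>S. bounded_linear S \<longrightarrow> S \<circ> A = A \<circ> S \<longrightarrow> S \<circ> B = B \<circ> S)"
proof -
  obtain B where B: "positive_selfadjoint B" "B \<circ> B = A"
    and comm: "\<And>S. bounded_linear S \<Longrightarrow> S \<circ> A = A \<circ> S \<Longrightarrow> S \<circ> B = B \<circ> S"
    using positive_selfadjoint_sqrt A unfolding positive_op_iff by metis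
  have "(\<lambda>x. c *\<^sub>C x) \<circ> B = B \<circ> (\<lambda>x. c *\<^sub>C x)" for c
    using A by (intro comm bounded_linear_scaleC)
      (simp add: positive_op_def bounded_clinear_def fun_eq_iff)
  then have "bounded_clinear B"
    using B(1) by (simp add: bounded_clinear_def positive_selfadjoint_def fun_eq_iff)
  with B comm show ?thesis unfolding positive_op_iff by blast
qed

lemma positive_op_inner:
  assumes "positive_op A"
  shows "inner (A x) y = inner x (A y)" and "0 \<le> inner (A x) x"
  using assms unfolding positive_op_iff positive_selfadjoint_def by blast+

lemma positive_op_kernel:
  fixes A :: "'a::chilbert_space \<Rightarrow> 'a"
  assumes "positive_op A" and "inner (A x) x = 0"
  shows "A x = 0"
  using assms by (simp add: positive_op_iff positive_selfadjoint_kernel)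

lemma positive_op_square:
  assumes B: "positive_op B"
  shows "positive_op (B \<circ> B)"
proof -
  have "bounded_clinear (B \<circ> B)"
    using B by (simp add: positive_op_def bounded_clinear_comp)
  moreover have "inner (B (B x)) y = inner x (B (B y))" for x y
    by (simp add: positive_op_inner(1)[OF B])
  moreover have "0 \<le> inner (B (B x)) x" for x
    by (subst positive_op_inner(1)[OF B]) simp
  ultimately show ?thesis
    by (simp add: positive_op_iff positive_selfadjoint_def bounded_clinear_linear)
qed

text \<open>
  Two roots of the same operator need not commute a priori, but each of them commutes with that
  operator and therefore with the root constructed above, to which it is then equal.
\<close>

lemma positive_sqrt_unique:
  fixes B C :: "'a::chilbert_space \<Rightarrow> 'a"
  assumes B: "positive_op B" and C: "positive_op C" and sq: "B \<circ> B = C \<circ> C"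
  shows "B = C"
proof -
  have "positive_op (B \<circ> B)"
    by (rule positive_op_square[OF B])
  then obtain D where D: "positive_op D" "D \<circ> D = B \<circ> B"
    and comm: "\<And>S. bounded_linear S \<Longrightarrow> S \<circ> (B \<circ> B) = (B \<circ> B) \<circ> S \<Longrightarrow> S \<circ> D = D \<circ> S"
    using positive_op_sqrt_exists by metis
  have "E = D" if E: "positive_op E" "E \<circ> E = B \<circ> B" for E
  proof (rule commuting_positive_sqrt_unique)
    show "E \<circ> D = D \<circ> E"
      using E by (intro comm) (simp_all add: positive_op_def bounded_clinear_def comp_assoc flip: E(2))
  qed (use E D in \<open>auto simp: positive_op_iff\<close>)
  from this[OF B refl] this[OF C sq[symmetric]] show ?thesis by simp
qed

lemma sqrt_op:
  fixes A :: "'a::chilbert_space \<Rightarrow> 'a"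
  assumes A: "positive_op A"
  shows positive_sqrt_op: "positive_op (sqrt_op A)"
    and sqrt_op_square: "sqrt_op A \<circ> sqrt_op A = A"
    and sqrt_op_commute: "bounded_linear S \<Longrightarrow> S \<circ> A = A \<circ> S \<Longrightarrow> S \<circ> sqrt_op A = sqrt_op A \<circ> S"
proof -
  obtain B where B: "positive_op B" "B \<circ> B = A"
    and comm: "\<And>S. bounded_linear S \<Longrightarrow> S \<circ> A = A \<circ> S \<Longrightarrow> S \<circ> B = B \<circ> S"
    using positive_op_sqrt_exists[OF A] by metis
  have "sqrt_op A = B"
    unfolding sqrt_op_def using B by (intro the_equality) (auto intro: positive_sqrt_unique)
  with B comm show "positive_op (sqrt_op A)" "sqrt_op A \<circ> sqrt_op A = A"
    "bounded_linear S \<Longrightarrow> S \<circ> A = A \<circ> S \<Longrightarrow> S \<circ> sqrt_op A = sqrt_op A \<circ> S"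
    by simp_all
qed

lemma positive_op_commute_of_square:
  fixes Q :: "'a::chilbert_space \<Rightarrow> 'a"
  assumes Q: "positive_op Q" and S: "bounded_linear S" "S \<circ> (Q \<circ> Q) = (Q \<circ> Q) \<circ> S"
  shows "S \<circ> Q = Q \<circ> S"
proof -
  have QQ: "positive_op (Q \<circ> Q)" by (rule positive_op_square[OF Q])
  have "sqrt_op (Q \<circ> Q) = Q"
    by (rule positive_sqrt_unique[OF positive_sqrt_op[OF QQ] Q sqrt_op_square[OF QQ]])
  then show ?thesis using sqrt_op_commute[OF QQ S] by simp
qed

lemma positive_cadjoint_comp:
  fixes T :: "'a::chilbert_space \<Rightarrow> 'a"
  assumes T: "bounded_clinear T"
  shows "positive_op (cadjoint T \<circ> T)"
proof -
  have "bounded_clinear (cadjoint T \<circ> T)"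
    by (intro bounded_clinear_comp bounded_clinear_cadjoint T)
  moreover have "inner (cadjoint T (T x)) y = inner (T x) (T y)" for x y
    using inner_cadjoint[OF T] by (metis inner_commute)
  ultimately show ?thesis
    by (simp add: positive_op_iff positive_selfadjoint_def bounded_clinear_linear
        flip: inner_cadjoint[OF T])
qed

section \<open>Polar decomposition\<close>

text \<open>
  On the orthogonal complement of the kernel \<open>V\<close> preserves norms, hence inner products. The vector
  \<open>d = V\<^sup>* V x - x\<close> lies in this complement, so \<open>\<parallel>d\<parallel>\<^sup>2 = \<langle>V x, V d\<rangle> - \<langle>x, d\<rangle> = 0\<close>.
\<close>

lemma partial_isometry_initial_space:
  fixes V :: "'a::chilbert_space \<Rightarrow> 'a"
  assumes V: "partial_isometry V" and x: "\<And>y. y \<in> ker V \<Longrightarrow> inner x y = 0"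
  shows "cadjoint V (V x) = x"
proof -
  have clin: "bounded_clinear V" using V by (simp add: partial_isometry_def)
  interpret V: bounded_linear V by (rule bounded_clinear_linear[OF clin])
  \<comment> \<open>The kernel is a complex subspace, so real orthogonality to it implies complex orthogonality.\<close>
  have isometric: "norm (V z) = norm z" if "\<And>y. y \<in> ker V \<Longrightarrow> inner z y = 0" for z
  proof -
    have "cinner z y = 0" if "y \<in> ker V" for y
    proof -
      have "\<i> *\<^sub>C y \<in> ker V"
        using that clin linear_0[OF bounded_linear.linear[OF bounded_linear_scaleC]]
        by (simp add: ker_def bounded_clinear_def)
      then show ?thesis
        using that \<open>\<And>y. y \<in> ker V \<Longrightarrow> inner z y = 0\<close> by (simp add: cinner_eq_Complex complex_eq_iff)
    qed
    then show ?thesis using V by (simp add: partial_isometry_def)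
  qed
  define d where "d = cadjoint V (V x) - x"
  have d: "inner d y = 0" if "y \<in> ker V" for y
    using that x[OF that] inner_cadjoint[OF clin, of y "V x"]
    by (simp add: d_def inner_diff_right inner_commute[of _ y] ker_def)
  have "inner (V x) (V d) = inner x d"
    using isometric[of "x + d"] isometric[of x] isometric[of d] x d
    by (simp add: inner_add_left V.add norm_eq_sqrt_inner inner_add_right inner_commute)
  then have "inner d d = 0"
    using inner_cadjoint[OF clin, of d "V x"]
    by (simp add: d_def inner_diff_left inner_diff_right inner_commute)
  then show ?thesis by (simp add: d_def)
qed

lemma bounded_clinear_add:
  "bounded_clinear S \<Longrightarrow> bounded_clinear T \<Longrightarrow> bounded_clinear (\<lambda>x. S x + T x)"
  by (simp add: bounded_clinear_def bounded_linear_add scaleC_add_right)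

lemma bounded_clinear_scaleR:
  "bounded_clinear T \<Longrightarrow> bounded_clinear (\<lambda>x. r *\<^sub>R T x)"
  using bounded_linear_const_scaleR[of T r]
  by (simp add: bounded_clinear_def scaleC_scaleC mult.commute flip: scaleC_of_real)

lemma abs_op:
  fixes T :: "'a::chilbert_space \<Rightarrow> 'a"
  assumes "bounded_clinear T"
  shows positive_abs_op: "positive_op (abs_op T)"
    and abs_op_square: "abs_op T (abs_op T x) = cadjoint T (T x)"
    and abs_op_commute: "bounded_linear S \<Longrightarrow> S \<circ> (cadjoint T \<circ> T) = (cadjoint T \<circ> T) \<circ> S
      \<Longrightarrow> S \<circ> abs_op T = abs_op T \<circ> S"
  using sqrt_op[OF positive_cadjoint_comp[OF assms]]
  unfolding abs_op_def by (auto simp: fun_eq_iff)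

lemma ker_abs_op:
  fixes T :: "'a::chilbert_space \<Rightarrow> 'a"
  assumes T: "bounded_clinear T"
  shows "ker (abs_op T) = ker T"
proof -
  have "inner (abs_op T x) (abs_op T x) = inner (T x) (T x)" for x
    using positive_op_inner(1)[OF positive_abs_op[OF T], of x "abs_op T x"]
    by (simp add: abs_op_square[OF T] inner_cadjoint[OF T])
  then show ?thesis
    unfolding ker_def by (metis inner_eq_zero_iff)
qed

text \<open>
  From \<open>(V - W) P = 0\<close>, where \<open>P = |T|\<close>, it follows by taking adjoints that \<open>P (V - W)\<^sup>* = 0\<close>, so the
  range of \<open>(V - W)\<^sup>*\<close> lies in \<open>ker P = ker V = ker W\<close>. Hence \<open>(V - W) (V - W)\<^sup>* = 0\<close>, which
  forces \<open>V = W\<close>.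
\<close>

lemma polar_factor_unique:
  fixes T :: "'a::chilbert_space \<Rightarrow> 'a"
  assumes T: "bounded_clinear T" and V: "polar_decomposition T V" and W: "polar_decomposition T W"
  shows "V = W"
proof -
  let ?P = "abs_op T"
  have lin: "bounded_clinear V" "bounded_clinear W"
    using V W by (simp_all add: polar_decomposition_def partial_isometry_def)
  have eq: "V (?P x) = W (?P x)" for x
    using V W unfolding polar_decomposition_def by (metis comp_apply)
  have D: "V (cadjoint V y - cadjoint W y) = W (cadjoint V y - cadjoint W y)" for y
  proof -
    have "?P (cadjoint V y - cadjoint W y) = 0"
    proof (rule inner_right_cancel)
      fix x
      have "inner x (?P (cadjoint V y - cadjoint W y)) = inner (?P x) (cadjoint V y - cadjoint W y)"
        by (simp add: positive_op_inner(1)[OF positive_abs_op[OF T]])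
      also have "\<dots> = inner x 0"
        by (simp add: inner_diff_right eq flip: inner_cadjoint[OF lin(1)] inner_cadjoint[OF lin(2)])
      finally show "inner x (?P (cadjoint V y - cadjoint W y)) = inner x 0" .
    qed
    then have "cadjoint V y - cadjoint W y \<in> ker V \<inter> ker W"
      using ker_abs_op[OF T] V W by (auto simp: polar_decomposition_def ker_def)
    then show ?thesis by (simp add: ker_def)
  qed
  have "cadjoint V y = cadjoint W y" for y
  proof -
    let ?d = "cadjoint V y - cadjoint W y"
    have "inner ?d ?d = inner (V ?d) y - inner (W ?d) y"
      by (simp only: inner_diff_right inner_cadjoint lin)
    then show ?thesis by (simp add: D)
  qed
  then have "inner (V x) y = inner (W x) y" for x y
    by (simp add: inner_cadjoint lin)
  then show ?thesis
    by (metis ext inner_commute inner_right_cancel)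
qed

lemma polar_factor_eq:
  fixes T :: "'a::chilbert_space \<Rightarrow> 'a"
  assumes "bounded_clinear T" and "polar_decomposition T V"
  shows "polar_factor T = V"
  unfolding polar_factor_def using assms by (intro the_equality) (auto intro: polar_factor_unique)

text \<open>
  The range of the self-adjoint operator \<open>|T|\<close> is orthogonal to its kernel, which is the kernel of
  \<open>V\<close>; so \<open>V\<close> is isometric on this range.
\<close>

lemma polar_initial_projection:
  fixes T :: "'a::chilbert_space \<Rightarrow> 'a"
  assumes T: "bounded_clinear T" and V: "polar_decomposition T V"
  shows "cadjoint V (V (abs_op T x)) = abs_op T x"
proof (rule partial_isometry_initial_space)
  show "partial_isometry V" using V by (simp add: polar_decomposition_def)
  fix y assume "y \<in> ker V"
  then have "abs_op T y = 0"
    using V ker_abs_op[OF T] by (simp add: polar_decomposition_def ker_def set_eq_iff)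
  then show "inner (abs_op T x) y = 0"
    by (simp add: positive_op_inner(1)[OF positive_abs_op[OF T]])
qed

section \<open>Kernels of the mean transform and of its adjoint\<close>

lemma cadjoint_mean_transform:
  fixes T :: "'a::chilbert_space \<Rightarrow> 'a"
  assumes T: "bounded_clinear T" and V: "polar_decomposition T V"
  shows "cadjoint (mean_transform T) =
    (\<lambda>x. (1 / 2) *\<^sub>R (abs_op T (cadjoint V x) + cadjoint V (abs_op T x)))"
proof (rule cadjoint_eqI)
  have V': "bounded_clinear V" and P: "bounded_clinear (abs_op T)"
    using V positive_abs_op[OF T]
    by (simp_all add: polar_decomposition_def partial_isometry_def positive_op_def)
  show "bounded_clinear (mean_transform T)"
    unfolding mean_transform_def polar_factor_eq[OF T V]
    using bounded_clinear_comp[OF V' P] bounded_clinear_comp[OF P V']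
    by (intro bounded_clinear_scaleR bounded_clinear_add) (simp_all add: comp_def)
  show "inner (mean_transform T x) y =
      inner x ((1 / 2) *\<^sub>R (abs_op T (cadjoint V y) + cadjoint V (abs_op T y)))" for x y
    by (simp add: mean_transform_def polar_factor_eq[OF T V] inner_add_left inner_add_right
        inner_cadjoint[OF V'] positive_op_inner(1)[OF positive_abs_op[OF T]])
qed

text \<open>
  If \<open>V P x = - P V x\<close>, where \<open>P = |T|\<close>, then \<open>\<langle>P x, x\<rangle> = \<langle>V P x, V x\<rangle> = - \<langle>P V x, V x\<rangle>\<close>, so two
  nonnegative quantities add up to zero.
\<close>

lemma ker_mean_transform:
  fixes T :: "'a::chilbert_space \<Rightarrow> 'a"
  assumes T: "bounded_clinear T" and V: "polar_decomposition T V"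
  shows "ker (mean_transform T) = ker T"
proof (intro set_eqI iffI)
  let ?P = "abs_op T"
  have V': "bounded_clinear V" using V by (simp add: polar_decomposition_def partial_isometry_def)
  have P: "positive_op ?P" by (rule positive_abs_op[OF T])
  have kerV: "x \<in> ker V \<longleftrightarrow> x \<in> ker T" and kerP: "x \<in> ker ?P \<longleftrightarrow> x \<in> ker T" for x
    using V ker_abs_op[OF T] by (simp_all add: polar_decomposition_def)
  interpret V: bounded_linear V by (rule bounded_clinear_linear[OF V'])
  interpret P: bounded_linear ?P using P by (simp add: positive_op_def bounded_clinear_linear)
  fix x
  {
    assume "x \<in> ker (mean_transform T)"
    then have sum: "V (?P x) + ?P (V x) = 0"
      by (simp add: ker_def mean_transform_def polar_factor_eq[OF T V])
    have "inner x (?P x) = inner x (cadjoint V (V (?P x)))"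
      by (simp add: polar_initial_projection[OF T V])
    also have "\<dots> = inner (V x) (V (?P x))"
      by (simp add: inner_cadjoint[OF V'])
    also have "\<dots> = - inner (?P (V x)) (V x)"
      using arg_cong[OF sum, of "inner (V x)"] by (simp add: inner_add_right inner_commute)
    finally have "inner (?P x) x \<le> 0"
      using positive_op_inner(2)[OF P, of "V x"] by (simp add: inner_commute)
    then have "?P x = 0"
      using positive_op_inner(2)[OF P, of x] by (simp add: positive_op_kernel[OF P])
    then show "x \<in> ker T" using kerP by (simp add: ker_def)
  }
  {
    assume "x \<in> ker T"
    then have "V x = 0" "?P x = 0" using kerV kerP by (auto simp: ker_def)
    then show "x \<in> ker (mean_transform T)"
      by (simp add: ker_def mean_transform_def polar_factor_eq[OF T V] V.zero P.zero)
  }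
qed

text \<open>
  With \<open>P = |T|\<close>, the operator \<open>Q = V P V\<^sup>*\<close> is \<open>|T\<^sup>*|\<close>, and the adjoint of the mean transform is \<open>V\<^sup>* (Q + P) / 2\<close>. As \<open>Q\<close> and \<open>V\<^sup>*\<close>
  have the same kernel, the kernel in question is that of \<open>Q\<^sup>2 + Q P\<close>. Binormality makes \<open>P\<close> and \<open>Q\<close>
  commute, so this is a sum of two positive operators.
\<close>

lemma ker_cadjoint_mean_transform_binormal:
  fixes T :: "'a::chilbert_space \<Rightarrow> 'a"
  assumes T: "bounded_clinear T" and V: "polar_decomposition T V" and binormal: "binormal T"
  shows "ker (cadjoint (mean_transform T)) = ker (cadjoint V)"
proof -
  let ?P = "abs_op T"
  let ?V' = "cadjoint V"
  have V_lin: "bounded_clinear V" using V by (simp add: polar_decomposition_def partial_isometry_def)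
  note adj = inner_cadjoint[OF V_lin]
  have V'_lin: "bounded_clinear ?V'" by (rule bounded_clinear_cadjoint[OF V_lin])
  have P: "positive_op ?P" by (rule positive_abs_op[OF T])
  have P_lin: "bounded_clinear ?P" using P by (simp add: positive_op_def)
  have T_eq: "T x = V (?P x)" for x
    using V unfolding polar_decomposition_def by (metis comp_apply)
  have V'V: "?V' (V (?P x)) = ?P x" for x by (rule polar_initial_projection[OF T V])
  interpret V: bounded_linear V by (rule bounded_clinear_linear[OF V_lin])
  interpret V': bounded_linear ?V' by (rule bounded_clinear_linear[OF V'_lin])
  interpret P: bounded_linear ?P by (rule bounded_clinear_linear[OF P_lin])
  have T': "cadjoint T = (\<lambda>x. ?P (?V' x))"
    by (rule cadjoint_eqI[OF T]) (simp add: T_eq adj positive_op_inner(1)[OF P])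
  define Q where "Q x = V (?P (?V' x))" for x
  have Q_lin: "bounded_clinear Q"
    using bounded_clinear_comp[OF V_lin bounded_clinear_comp[OF P_lin V'_lin]]
    by (simp add: Q_def[abs_def] comp_def)
  have Q_form: "inner (Q x) y = inner (?P (?V' x)) (?V' y)" for x y
    by (simp add: Q_def adj)
  have Q: "positive_op Q"
    unfolding positive_op_iff positive_selfadjoint_def
  proof (intro conjI allI Q_lin bounded_clinear_linear)
    show "inner (Q x) y = inner x (Q y)" for x y
      using Q_form[of x y] Q_form[of y x] positive_op_inner(1)[OF P, of "?V' x" "?V' y"]
      by (simp add: inner_commute)
    show "0 \<le> inner (Q x) x" for x
      by (simp add: Q_form positive_op_inner(2)[OF P])
  qed
  interpret Q: bounded_linear Q by (rule bounded_clinear_linear[OF Q_lin])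
  have Q_sq: "Q \<circ> Q = T \<circ> cadjoint T"
    by (simp add: fun_eq_iff Q_def V'V T' T_eq)
  have Q_ker: "Q x = 0 \<longleftrightarrow> ?V' x = 0" for x
  proof
    assume "Q x = 0"
    then have "?P (?V' x) = 0"
      using Q_form[of x x] by (simp add: positive_op_kernel[OF P])
    then have "V (?V' x) = 0"
      using V ker_abs_op[OF T] by (auto simp: polar_decomposition_def ker_def set_eq_iff)
    then show "?V' x = 0"
      using adj[of "?V' x" x] by simp
  qed (simp add: Q_def P.zero V.zero)
  have "bounded_linear (Q \<circ> Q)"
    by (intro bounded_clinear_linear bounded_clinear_comp Q_lin)
  then have "(T \<circ> cadjoint T) \<circ> ?P = ?P \<circ> (T \<circ> cadjoint T)"
    using binormal unfolding binormal_def Q_sq[symmetric] by (metis abs_op_commute[OF T])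
  then have "?P \<circ> (Q \<circ> Q) = (Q \<circ> Q) \<circ> ?P" by (simp add: Q_sq)
  then have PQ: "?P \<circ> Q = Q \<circ> ?P"
    by (rule positive_op_commute_of_square[OF Q P.bounded_linear_axioms])
  have mean_ker: "x \<in> ker (cadjoint (mean_transform T)) \<longleftrightarrow> Q (Q x + ?P x) = 0" for x
    unfolding Q_ker
    by (simp add: ker_def cadjoint_mean_transform[OF T V] V'.add Q_def V'V)
  show ?thesis
  proof (intro set_eqI iffI)
    fix x assume "x \<in> ker (cadjoint (mean_transform T))"
    then have "inner (Q (Q x)) x + inner (Q (?P x)) x = 0"
      using mean_ker[of x] by (simp add: Q.add flip: inner_add_left)
    moreover have "inner (Q (Q x)) x = inner (Q x) (Q x)"
      by (simp add: positive_op_inner(1)[OF Q])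
    moreover have "0 \<le> inner (Q (?P x)) x"
      using commuting_positive_product_nonneg[OF _ _ PQ] P Q by (simp add: positive_op_iff)
    ultimately have "inner (Q x) (Q x) \<le> 0" by linarith
    then have "Q x = 0" by (metis inner_gt_zero_iff not_le)
    then show "x \<in> ker ?V'" by (simp add: ker_def Q_ker)
  next
    fix x assume "x \<in> ker ?V'"
    then have "Q x = 0" by (simp add: ker_def Q_ker)
    then have "Q (?P x) = 0" using PQ by (metis comp_apply P.zero)
    then show "x \<in> ker (cadjoint (mean_transform T))"
      using \<open>Q x = 0\<close> by (simp add: mean_ker Q.add)
  qed
qed

theorem proposition2p1:
  fixes T V :: "'a::chilbert_space \<Rightarrow> 'a"
  assumes "bounded_clinear T"
    and "polar_decomposition T V"
  shows "ker (mean_transform T) = ker T \<and> ker T = ker V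
    \<and> ker (cadjoint V) \<inter> ker V \<subseteq> ker (cadjoint (mean_transform T))
    \<and> (binormal T \<longrightarrow> ker (cadjoint (mean_transform T)) = ker (cadjoint V))"
proof (intro conjI impI)
  show ker: "ker T = ker V"
    using assms(2) by (simp add: polar_decomposition_def)
  show "ker (mean_transform T) = ker T"
    by (rule ker_mean_transform[OF assms])
  show "ker (cadjoint V) \<inter> ker V \<subseteq> ker (cadjoint (mean_transform T))"
  proof
    fix x assume x: "x \<in> ker (cadjoint V) \<inter> ker V"
    then have "x \<in> ker (abs_op T)" by (simp add: ker_abs_op[OF assms(1)] ker)
    moreover have "abs_op T 0 = 0" "cadjoint V 0 = 0"
    proof -
      have "bounded_linear (abs_op T)" "bounded_linear (cadjoint V)"
        using positive_abs_op[OF assms(1)] assms(2)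
        by (simp_all add: positive_op_def polar_decomposition_def partial_isometry_def
            bounded_clinear_linear bounded_clinear_cadjoint)
      then show "abs_op T 0 = 0" "cadjoint V 0 = 0"
        by (simp_all add: linear_0 bounded_linear.linear)
    qed
    ultimately show "x \<in> ker (cadjoint (mean_transform T))"
      using x by (simp add: ker_def cadjoint_mean_transform[OF assms])
  qed
  show "ker (cadjoint (mean_transform T)) = ker (cadjoint V)" if "binormal T"
    using assms that by (rule ker_cadjoint_mean_transform_binormal)
qed

end
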